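(* Let $$K_0=\Big(\big(\{0\}\cup\{\tfrac1n: n\in\mathbb{N}\}\big)\times[0,1]^2\Big)\cup\big([0,1]^2\times\{0\}\big)\subset\mathbb{R}^3,$$ where $\mathbb{N}=\{1,2,\dots\}$. Let $\mathcal{D}_1$ be the decomposition of $K_0$ consisting of all the line segments $\{0\}\times\{x_2\}\times[0,1]$ with $x_2\in[0,1]$ and all the singletons $\{(x_1,x_2,x_3)\}$ with $(x_1,x_2,x_3)\in K_0$ and $x_1>0$. For $\lambda\in(0,1)$ let $h_\lambda:K_0\to K_0$ be the homeomorphism $$h_\lambda(x_1,x_2,x_3)=\big(x_1,\;x_2+4x_3(1-x_3)(x_2^\lambda-x_2),\;x_3\big),$$ and let $h_\lambda(\mathcal{D}_1)=\{h_\lambda(\delta):\delta\in\mathcal{D}_1\}$. Then $\mathcal{D}_1$ is an atomic decomposition of $K_0$ (with Peano quotient). Hence, for every $\lambda\in(0,1)$, $h_\lambda(\mathcal{D}_1)$ is an atomic decomposition of $K_0$.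
   Context: A compactum is a compact metric space; a continuum is a connected compactum (possibly a single point). Upper semi-continuous (usc) decomposition: a partition $\mathcal{D}$ of a space $X$ into closed subsets such that for each $\delta\in\mathcal{D}$ and each open $U\supset\delta$ there is an open set $V$ with $\delta\subset V\subset U$ such that $V$ is a union of elements of $\mathcal{D}$. It is a usc decomposition into subcontinua if each element is connected. A decomposition $\mathcal{D}$ refines $\mathcal{D}'$ if every element of $\mathcal{D}$ is contained in an element of $\mathcal{D}'$. Peano compactum: a compact metric space such that for every $\varepsilon>0$ at most finitely many components have diameter greater than $\varepsilon$, and every nondegenerate component is a Peano continuum (equivalently, is locally connected). A Peano decomposition of a compactum $K$ is a usc decomposition of $K$ into subcontinua whose quotient space is a Peano compactum. An atomic decomposition of $K$ (with Peano quotient) is a Peano decomposition $\mathcal{D}$ of $K$ such that no other Peano decomposition of $K$ refines $\mathcal{D}$. *)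

theory Defs
  imports "HOL-Analysis.Analysis" "HOL-Library.Disjoint_Sets"
begin

definition compactum :: "'a topology \<Rightarrow> bool" where
  "compactum X \<longleftrightarrow> compact_space X \<and> metrizable_space X"

definition continuum :: "'a topology \<Rightarrow> bool" where
  "continuum X \<longleftrightarrow> compactum X \<and> connected_space X \<and> topspace X \<noteq> {}"

definition peano_continuum :: "'a topology \<Rightarrow> bool" where
  "peano_continuum X \<longleftrightarrow> continuum X \<and> locally_connected_space X"

text \<open>The analogue of \<^const>\<open>diameter\<close> for an abstract metric.\<close>

definition mdiameter :: "'a metric \<Rightarrow> 'a set \<Rightarrow> real" where
  "mdiameter m S = (if S = {} then 0 else SUP (x,y)\<in>S\<times>S. mdist m x y)"

definition peano_compactum_metric :: "'a metric \<Rightarrow> bool" where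
  "peano_compactum_metric m \<longleftrightarrow>
     compact_space (mtopology_of m) \<and>
     (\<forall>\<epsilon>>0. finite {C \<in> connected_components_of (mtopology_of m). mdiameter m C > \<epsilon>}) \<and>
     (\<forall>C \<in> connected_components_of (mtopology_of m).
        \<not> is_singleton C \<longrightarrow> peano_continuum (subtopology (mtopology_of m) C))"

text \<open>A quotient space carries no distinguished metric. For compact spaces the condition on
  diameters does not depend on the choice of a compatible metric, since any two such metrics
  are uniformly equivalent; so asking for some compatible metric is unambiguous.\<close>

definition peano_compactum :: "'a topology \<Rightarrow> bool" where
  "peano_compactum X \<longleftrightarrow> (\<exists>m. mtopology_of m = X \<and> peano_compactum_metric m)"

definition usc_decomposition :: "'a topology \<Rightarrow> 'a set set \<Rightarrow> bool" where
  "usc_decomposition X \<D> \<longleftrightarrow>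
     partition_on (topspace X) \<D> \<and>
     (\<forall>\<delta>\<in>\<D>. closedin X \<delta>) \<and>
     (\<forall>\<delta>\<in>\<D>. \<forall>U. openin X U \<and> \<delta> \<subseteq> U \<longrightarrow>
        (\<exists>V. openin X V \<and> \<delta> \<subseteq> V \<and> V \<subseteq> U \<and> (\<exists>\<E>\<subseteq>\<D>. V = \<Union>\<E>)))"

definition usc_decomposition_into_subcontinua :: "'a topology \<Rightarrow> 'a set set \<Rightarrow> bool" where
  "usc_decomposition_into_subcontinua X \<D> \<longleftrightarrow>
     usc_decomposition X \<D> \<and> (\<forall>\<delta>\<in>\<D>. connectedin X \<delta>)"

text \<open>The points of the quotient space are the elements of the decomposition. The preimage of
  a set \<open>\<U>\<close> of such points under the projection is \<open>\<Union>\<U>\<close>. The open sets below form a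
  topology only because \<open>\<D>\<close> is a partition, see the lemmas that follow.\<close>

definition decomposition_space :: "'a topology \<Rightarrow> 'a set set \<Rightarrow> 'a set topology" where
  "decomposition_space X \<D> = topology (\<lambda>\<U>. \<U> \<subseteq> \<D> \<and> openin X (\<Union>\<U>))"

lemma openin_decomposition_space:
  assumes "partition_on (topspace X) \<D>"
  shows "openin (decomposition_space X \<D>) \<U> \<longleftrightarrow> \<U> \<subseteq> \<D> \<and> openin X (\<Union>\<U>)"
proof -
  have "istopology (\<lambda>\<U>. \<U> \<subseteq> \<D> \<and> openin X (\<Union>\<U>))"
    unfolding istopology_def
  proof (intro conjI allI impI; (elim conjE)?)
    fix S T assume S: "S \<subseteq> \<D>" "openin X (\<Union>S)" and T: "T \<subseteq> \<D>" "openin X (\<Union>T)"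
    have "\<delta> = \<delta>'" if "x \<in> \<delta>" "x \<in> \<delta>'" "\<delta> \<in> \<D>" "\<delta>' \<in> \<D>" for x \<delta> \<delta>'
      using that disjointD[OF partition_onD2[OF assms], of \<delta> \<delta>'] by auto
    then have "\<Union>(S \<inter> T) = \<Union>S \<inter> \<Union>T" using S(1) T(1) by blast
    then show "openin X (\<Union>(S \<inter> T))" "S \<inter> T \<subseteq> \<D>" using S T by auto
  next
    fix \<K> assume "\<forall>K\<in>\<K>. K \<subseteq> \<D> \<and> openin X (\<Union>K)"
    moreover have "\<Union>(\<Union>\<K>) = \<Union>(Union ` \<K>)" by blast
    ultimately show "openin X (\<Union>(\<Union>\<K>))" "\<Union>\<K> \<subseteq> \<D>" by auto
  qed
  then show ?thesis by (simp add: decomposition_space_def)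
qed

lemma topspace_decomposition_space:
  assumes "partition_on (topspace X) \<D>"
  shows "topspace (decomposition_space X \<D>) = \<D>"
proof -
  have "openin (decomposition_space X \<D>) \<D>"
    using assms by (simp add: openin_decomposition_space partition_on_def)
  then show ?thesis
    by (metis assms openin_decomposition_space openin_subset openin_topspace subset_antisym)
qed

lemma quotient_map_decomposition_space:
  assumes "partition_on (topspace X) \<D>"
    and "\<And>x. x \<in> topspace X \<Longrightarrow> x \<in> \<pi> x \<and> \<pi> x \<in> \<D>"
  shows "quotient_map X (decomposition_space X \<D>) \<pi>"
proof -
  have un: "topspace X = \<Union>\<D>"
    using assms(1) by (rule partition_onD1)
  have uniq: "\<pi> x = \<delta>" if "x \<in> \<delta>" "\<delta> \<in> \<D>" for x \<delta>
  proof -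
    have "x \<in> \<pi> x" "\<pi> x \<in> \<D>" using assms(2)[of x] that un by auto
    then show ?thesis
      using that disjointD[OF partition_onD2[OF assms(1)], of "\<pi> x" \<delta>] by auto
  qed
  have "\<delta> \<in> \<pi> ` topspace X" if "\<delta> \<in> \<D>" for \<delta>
  proof -
    have "\<delta> \<noteq> {}" using partition_onD3[OF assms(1)] that by auto
    then obtain x where "x \<in> \<delta>" by auto
    with that show ?thesis using uniq[of x \<delta>] un by auto
  qed
  then have img: "\<pi> ` topspace X = \<D>"
    using assms(2) by auto
  have "{x \<in> topspace X. \<pi> x \<in> U} = \<Union>U" if "U \<subseteq> \<D>" for U
  proof (intro set_eqI iffI)
    fix x assume "x \<in> {x \<in> topspace X. \<pi> x \<in> U}"
    then show "x \<in> \<Union>U" using assms(2)[of x] by auto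
  next
    fix x assume "x \<in> \<Union>U"
    then obtain \<delta> where "x \<in> \<delta>" "\<delta> \<in> U" by auto
    then show "x \<in> {x \<in> topspace X. \<pi> x \<in> U}" using uniq[of x \<delta>] that un by auto
  qed
  then show ?thesis
    by (simp add: quotient_map_def img openin_decomposition_space[OF assms(1)]
        topspace_decomposition_space[OF assms(1)])
qed

definition peano_decomposition :: "'a topology \<Rightarrow> 'a set set \<Rightarrow> bool" where
  "peano_decomposition X \<D> \<longleftrightarrow>
     compactum X \<and> usc_decomposition_into_subcontinua X \<D> \<and>
     peano_compactum (decomposition_space X \<D>)"

definition atomic_decomposition :: "'a topology \<Rightarrow> 'a set set \<Rightarrow> bool" where
  "atomic_decomposition X \<D> \<longleftrightarrow>
     peano_decomposition X \<D> \<and>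
     \<not> (\<exists>\<D>'. \<D>' \<noteq> \<D> \<and> peano_decomposition X \<D>' \<and> refines (topspace X) \<D>' \<D>)"

definition K0 :: "(real \<times> real \<times> real) set" where
  "K0 = ({0} \<union> {1 / real n |n. n \<ge> 1}) \<times> {0..1} \<times> {0..1} \<union> {0..1} \<times> {0..1} \<times> {0}"

definition D1 :: "(real \<times> real \<times> real) set set" where
  "D1 = {{0} \<times> {x2} \<times> {0..1} |x2. x2 \<in> {0..1}} \<union>
        {{(x1, x2, x3)} |x1 x2 x3. (x1, x2, x3) \<in> K0 \<and> x1 > 0}"

definition h :: "real \<Rightarrow> real \<times> real \<times> real \<Rightarrow> real \<times> real \<times> real" where
  "h l = (\<lambda>(x1, x2, x3). (x1, x2 + 4 * x3 * (1 - x3) * (x2 powr l - x2), x3))"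

end

theory Submission
  imports Defs
begin

text \<open>The map \<open>(x, y, z) \<mapsto> (x, y, x * z)\<close> has the elements of \<open>D1\<close> as its fibres, so the quotient is
  the square with plates of height \<open>1 / n\<close> standing on it. The shrinking heights make it locally
  connected. In a Peano decomposition strictly refining \<open>D1\<close>, some part over \<open>x = 0\<close> would miss the
  floor. Near such a part the space looks like a product with \<open>{0} \<union> {1 / n}\<close>, and the first
  coordinate, which descends to the quotient, rules out small connected neighbourhoods there. The
  minimality argument uses only the first and third coordinates of points in one part; the
  homeomorphisms \<open>h l\<close> preserve these, so it applies to the images of \<open>D1\<close> as well.\<close>

section \<open>Peano continua and decompositions into fibres\<close>

text \<open>A connected space has a single component, so the finiteness condition on diameters holds
  for every compatible metric, and the component condition is the assumption itself.\<close>

lemma peano_compactum_if_peano_continuum: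
  assumes "peano_continuum X"
  shows "peano_compactum X"
proof -
  have cont: "compact_space X" "metrizable_space X" "connected_space X" "topspace X \<noteq> {}"
    using assms by (auto simp: peano_continuum_def continuum_def compactum_def)
  then obtain M d where Md: "Metric_space M d" "X = Metric_space.mtopology M d"
    unfolding metrizable_space_def by blast
  then have m: "mtopology_of (metric (M, d)) = X"
    by (simp add: Metric_space.mtopology_of)
  have comps: "connected_components_of X = {topspace X}"
    using cont connected_components_of_connected_space[of X] by auto
  have "peano_compactum_metric (metric (M, d))"
    unfolding peano_compactum_metric_def m comps using cont assms by simp
  then show ?thesis
    using m unfolding peano_compactum_def by blast
qed

text \<open>The two distinct points make the only component nondegenerate, and it is for
  nondegenerate components that a Peano compactum promises local connectedness.\<close>

lemma locally_connected_if_peano_compactum: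
  assumes "peano_compactum X" "connected_space X" "x \<in> topspace X" "y \<in> topspace X" "x \<noteq> y"
  shows "locally_connected_space X"
proof -
  obtain m where m: "mtopology_of m = X" "peano_compactum_metric m"
    using assms(1) unfolding peano_compactum_def by blast
  have "topspace X \<in> connected_components_of X"
    using connected_components_of_connected_space[of X] assms(2,3) by auto
  moreover have "\<not> is_singleton (topspace X)"
    using assms by (auto simp: is_singleton_def)
  ultimately have "peano_continuum (subtopology X (topspace X))"
    using m unfolding peano_compactum_metric_def by metis
  then show ?thesis
    by (simp add: peano_continuum_def)
qed

text \<open>Fibres are indexed by points of the space rather than by values, so that none is empty
  even when \<open>f\<close> is not surjective.\<close>

definition fibres :: "'a topology \<Rightarrow> ('a \<Rightarrow> 'b) \<Rightarrow> 'a set set" where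
  "fibres X f = (\<lambda>x. {x' \<in> topspace X. f x' = f x}) ` topspace X"

lemma partition_on_fibres: "partition_on (topspace X) (fibres X f)"
  by (rule partition_onI) (auto simp: fibres_def disjnt_iff)

lemma usc_decomposition_fibres:
  assumes f: "continuous_map X Y f" and cl: "closed_map X Y f" and Y: "Hausdorff_space Y"
  shows "usc_decomposition X (fibres X f)"
  unfolding usc_decomposition_def
proof (intro conjI ballI allI impI)
  show "partition_on (topspace X) (fibres X f)"
    by (rule partition_on_fibres)
next
  fix \<delta> assume "\<delta> \<in> fibres X f"
  then obtain x where x: "x \<in> topspace X" "\<delta> = {x' \<in> topspace X. f x' \<in> {f x}}"
    by (auto simp: fibres_def)
  have "f x \<in> topspace Y"
    using f x(1) by (auto simp: continuous_map_def)
  then show "closedin X \<delta>"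
    unfolding x(2) by (intro closedin_continuous_map_preimage[OF f] closedin_Hausdorff_singleton Y)
next
  fix \<delta> U assume \<delta>: "\<delta> \<in> fibres X f" and U: "openin X U \<and> \<delta> \<subseteq> U"
  obtain x where x: "x \<in> topspace X" "\<delta> = {x' \<in> topspace X. f x' = f x}"
    using \<delta> by (auto simp: fibres_def)
  \<comment> \<open>Since \<open>f\<close> is closed, \<open>C\<close> is closed. The preimage
    \<open>V\<close> of its complement is the largest union of fibres inside
    \<open>U\<close>.\<close>
  define C where "C = f ` (topspace X - U)"
  have "closedin Y C"
    using cl U unfolding closed_map_def C_def by (auto intro: closedin_diff)
  define V where "V = {x \<in> topspace X. f x \<in> topspace Y - C}"
  have "openin X V"
    unfolding V_def using \<open>closedin Y C\<close> by (intro openin_continuous_map_preimage[OF f]) auto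
  moreover have "\<delta> \<subseteq> V"
    using x U f by (auto simp: V_def C_def continuous_map_def)
  moreover have "V \<subseteq> U"
    by (auto simp: V_def C_def)
  moreover have "V = \<Union>{\<delta> \<in> fibres X f. \<delta> \<subseteq> V}"
  proof
    show "V \<subseteq> \<Union>{\<delta> \<in> fibres X f. \<delta> \<subseteq> V}"
    proof
      fix v assume "v \<in> V"
      then have "{x' \<in> topspace X. f x' = f v} \<in> fibres X f" "{x' \<in> topspace X. f x' = f v} \<subseteq> V"
        "v \<in> {x' \<in> topspace X. f x' = f v}"
        by (auto simp: V_def fibres_def)
      then show "v \<in> \<Union>{\<delta> \<in> fibres X f. \<delta> \<subseteq> V}"
        by blast
    qed
  qed auto
  ultimately show "\<exists>V. openin X V \<and> \<delta> \<subseteq> V \<and> V \<subseteq> U \<and> (\<exists>\<E>\<subseteq>fibres X f. V = \<Union>\<E>)"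
    by (metis (no_types, lifting) mem_Collect_eq subsetI)
qed

text \<open>This presents the image of a fibre decomposition under a homeomorphism as a fibre
  decomposition again, namely of the map composed with the inverse.\<close>

lemma fibres_comp_homeomorphic:
  assumes "homeomorphic_maps X Y \<phi> \<psi>"
  shows "fibres Y (f \<circ> \<psi>) = (`) \<phi> ` fibres X f"
proof -
  have \<phi>: "\<phi> x \<in> topspace Y" "\<psi> (\<phi> x) = x" if "x \<in> topspace X" for x
    using assms that by (auto simp: homeomorphic_maps_def continuous_map_def)
  have \<psi>: "\<psi> y \<in> topspace X" "\<phi> (\<psi> y) = y" if "y \<in> topspace Y" for y
    using assms that by (auto simp: homeomorphic_maps_def continuous_map_def)
  have Y: "topspace Y = \<phi> ` topspace X"
    using \<phi> \<psi> by (force simp: image_iff)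
  have fibre: "\<phi> ` {x' \<in> topspace X. f x' = f x} = {y \<in> topspace Y. f (\<psi> y) = f (\<psi> (\<phi> x))}"
    if "x \<in> topspace X" for x
    using \<phi> \<psi> that by (force simp: image_iff)
  show ?thesis
    unfolding fibres_def Y image_image comp_def
    by (intro image_cong refl) (use fibre Y in simp)
qed

lemma decomposition_space_fibres:
  assumes f: "quotient_map X Y f"
  shows "decomposition_space X (fibres X f) homeomorphic_space Y"
proof -
  let ?D = "decomposition_space X (fibres X f)"
  define \<pi> where "\<pi> x = {x' \<in> topspace X. f x' = f x}" for x
  \<comment> \<open>\<open>F\<close> is the map induced on the quotient: \<open>f\<close> is
    constant on a fibre, so the choice of the point does not affect the value.\<close>
  define F where "F \<delta> = f (SOME x. x \<in> \<delta>)" for \<delta>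
  have q: "quotient_map X ?D \<pi>"
    by (rule quotient_map_decomposition_space[OF partition_on_fibres]) (auto simp: \<pi>_def fibres_def)
  have F: "F (\<pi> x) = f x" if "x \<in> topspace X" for x
  proof -
    have "x \<in> \<pi> x"
      using that by (simp add: \<pi>_def)
    then have "(SOME x'. x' \<in> \<pi> x) \<in> \<pi> x"
      by (rule someI)
    then show ?thesis
      by (simp add: \<pi>_def F_def)
  qed
  have "quotient_map X Y (F \<circ> \<pi>)"
    using quotient_map_eq[OF f, of "F \<circ> \<pi>"] F by simp
  then have "quotient_map ?D Y F"
    using quotient_map_compose_eq[OF q] by blast
  moreover have "inj_on F (topspace ?D)"
  proof -
    have "topspace ?D = \<pi> ` topspace X"
      using q by (simp add: quotient_map_def)
    then show ?thesis
      using F by (auto simp: inj_on_def) (auto simp: \<pi>_def)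
  qed
  ultimately have "homeomorphic_map ?D Y F"
    by (simp add: homeomorphic_map_def)
  then show ?thesis
    by (rule homeomorphic_map_imp_homeomorphic_space)
qed

text \<open>A continuous map from a compact space to a Hausdorff space is closed. Closedness makes
  the fibres upper semi-continuous and \<open>f\<close> a quotient map, so the decomposition space
  is a copy of \<open>Y\<close>.\<close>

lemma peano_decomposition_fibres:
  assumes X: "compactum X" and Y: "peano_continuum Y"
    and f: "continuous_map X Y f" "f ` topspace X = topspace Y"
    and conn: "\<And>\<delta>. \<delta> \<in> fibres X f \<Longrightarrow> connectedin X \<delta>"
  shows "peano_decomposition X (fibres X f)"
proof -
  have Y': "Hausdorff_space Y" "compact_space Y" "metrizable_space Y" "connected_space Y"
      "locally_connected_space Y" "topspace Y \<noteq> {}"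
    using Y metrizable_imp_Hausdorff_space
    by (auto simp: peano_continuum_def continuum_def compactum_def)
  have "closed_map X Y f"
    using X Y'(1) f(1) by (intro continuous_imp_closed_map_gen) (auto simp: compactum_def Hausdorff_imp_kc_space)
  then have "quotient_map X Y f"
    using f continuous_closed_imp_quotient_map by blast
  then have hom: "decomposition_space X (fibres X f) homeomorphic_space Y"
    by (rule decomposition_space_fibres)
  have "peano_continuum (decomposition_space X (fibres X f))"
    unfolding peano_continuum_def continuum_def compactum_def
    using Y' hom homeomorphic_compact_space homeomorphic_metrizable_space homeomorphic_connected_space
      homeomorphic_locally_connected_space homeomorphic_empty_space
    by (metis null_topspace_iff_trivial)
  then show ?thesis
    unfolding peano_decomposition_def usc_decomposition_into_subcontinua_def
    using X usc_decomposition_fibres[OF f(1) \<open>closed_map X Y f\<close> Y'(1)] conn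
      peano_compactum_if_peano_continuum by blast
qed

section \<open>The compactum and its quotient\<close>

text \<open>Each point of \<open>S\<close> hangs on the connected base by a vertical segment inside
  \<open>S\<close>, so \<open>S\<close> is a union of connected sets that all contain the
  base.\<close>

lemma connected_vertical:
  fixes S :: "('a::topological_space \<times> 'b::topological_space \<times> real) set"
  assumes seg: "\<And>x y z. (x, y, z) \<in> S \<Longrightarrow> {x} \<times> {y} \<times> {0..z} \<subseteq> S \<and> 0 \<le> z"
    and base: "connected {(x, y). (x, y, 0) \<in> S}"
  shows "connected S"
proof (cases "S = {}")
  case False
  define B where "B = (\<lambda>(x, y). (x, y, 0::real)) ` {(x, y). (x, y, 0) \<in> S}"
  define P where "P = (\<lambda>(x::'a, y::'b, z::real). B \<union> {x} \<times> {y} \<times> {0..z})"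
  have "connected B"
    unfolding B_def case_prod_unfold using base
    by (intro connected_continuous_image continuous_intros) (simp add: case_prod_unfold)
  have inB: "(x, y, 0) \<in> B" if "(x, y, z) \<in> S" for x y z
  proof -
    have "(x, y, 0) \<in> S"
      using seg[OF that] by auto
    then show ?thesis
      by (force simp: B_def)
  qed
  have conn: "connected (P p)" if "p \<in> S" for p
  proof -
    obtain x y z where p: "p = (x, y, z)"
      by (cases p)
    have "(x, y, 0) \<in> B \<inter> {x} \<times> {y} \<times> {0..z}"
      using inB that seg p by auto
    then have "B \<inter> {x} \<times> {y} \<times> {0..z} \<noteq> {}"
      by blast
    then show ?thesis
      unfolding p P_def prod.case
      by (intro connected_Un \<open>connected B\<close> connected_Times) auto
  qed
  have eq: "\<Union>(P ` S) = S"
  proof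
    show "S \<subseteq> \<Union>(P ` S)"
    proof
      fix p assume "p \<in> S"
      moreover have "p \<in> P p"
        using seg \<open>p \<in> S\<close> by (cases p) (auto simp: P_def)
      ultimately show "p \<in> \<Union>(P ` S)"
        by blast
    qed
    have "P p \<subseteq> S" if "p \<in> S" for p
      using seg that by (cases p) (fastforce simp: P_def B_def)
    then show "\<Union>(P ` S) \<subseteq> S"
      by blast
  qed
  have ne: "\<Inter>(P ` S) \<noteq> {}"
  proof -
    obtain x y z where "(x, y, z) \<in> S"
      using False by (metis ex_in_conv prod_cases3)
    then have "(x, y, 0) \<in> \<Inter>(P ` S)"
      using inB by (auto simp: P_def)
    then show ?thesis
      by blast
  qed
  have "connected (\<Union>(P ` S))"
    by (rule connected_Union[OF _ ne]) (use conn in blast)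
  then show ?thesis
    by (simp only: eq)
qed simp

section \<open>Compactness and connectedness of \<open>K0\<close>\<close>

lemma K0_iff:
  "(x, y, z) \<in> K0 \<longleftrightarrow> 0 \<le> x \<and> x \<le> 1 \<and> 0 \<le> y \<and> y \<le> 1 \<and> 0 \<le> z \<and> z \<le> 1 \<and>
     (z = 0 \<or> x = 0 \<or> (\<exists>n::nat. n \<ge> 1 \<and> x = 1 / real n))"
  by (auto simp: K0_def)

lemma compact_K0: "compact K0"
proof -
  \<comment> \<open>The positions of the plates form a convergent sequence together with its limit
    \<open>0\<close>, hence a compact set.\<close>
  have "insert 0 (range (\<lambda>n. 1 / real (Suc n))) = {0} \<union> {1 / real n |n. n \<ge> 1}"
    by (auto simp del: of_nat_Suc) (metis Suc_le_D rangeI)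
  moreover have "compact (insert 0 (range (\<lambda>n. 1 / real (Suc n))))"
    by (intro compact_sequence_with_limit lim_1_over_n[THEN LIMSEQ_Suc])
  ultimately have plates: "compact ({0} \<union> {1 / real n |n. n \<ge> 1})"
    by metis
  show ?thesis
    unfolding K0_def by (intro compact_Un[OF compact_Times[OF plates]] compact_Times) auto
qed

lemma connected_K0: "connected K0"
proof (rule connected_vertical)
  have "{(x, y). (x, y, 0) \<in> K0} = {0..1} \<times> {0..1}"
    by (auto simp: K0_iff)
  then show "connected {(x, y). (x, y, 0) \<in> K0}"
    by (simp add: connected_Times)
qed (auto simp: K0_iff)

lemma compactum_K0: "compactum (top_of_set K0)"
  using compact_K0 by (simp add: compactum_def compact_space_subtopology metrizable_space_euclidean
      metrizable_space_subtopology)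

section \<open>The collapsed space and its local connectedness\<close>

definition collapse :: "real \<times> real \<times> real \<Rightarrow> real \<times> real \<times> real" where
  "collapse = (\<lambda>(x, y, z). (x, y, x * z))"

lemma collapse_K0_iff:
  "(x, y, z) \<in> collapse ` K0 \<longleftrightarrow> x \<le> 1 \<and> 0 \<le> y \<and> y \<le> 1 \<and> 0 \<le> z \<and> z \<le> x \<and>
     (z = 0 \<or> (\<exists>n::nat. n \<ge> 1 \<and> x = 1 / real n))" (is "?L \<longleftrightarrow> ?R")
proof
  assume ?L
  then obtain t where "(x, y, t) \<in> K0" "z = x * t"
    by (auto simp: collapse_def)
  then show ?R
    unfolding K0_iff by (auto simp: mult_left_le)
next
  assume R: ?R
  \<comment> \<open>For \<open>x = 0\<close> the bounds force \<open>z = 0\<close>, and the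
    convention \<open>0 / 0 = 0\<close> selects the floor point as preimage.\<close>
  have "(x, y, z / x) \<in> K0" "collapse (x, y, z / x) = (x, y, z)"
    using R by (auto simp: K0_iff collapse_def divide_simps)
  then show ?L
    by (metis image_eqI)
qed

text \<open>The reciprocal nearest to \<open>1 / n\<close> is \<open>1 / (n + 1)\<close>, at
  distance exactly \<open>1 / (n * (n + 1))\<close>.\<close>

lemma one_over_nat_isolated:
  fixes m n :: nat
  assumes "m \<ge> 1" "n \<ge> 1" "\<bar>1 / real m - 1 / real n\<bar> < 1 / (real n * (real n + 1))"
  shows "m = n"
proof (rule ccontr)
  assume "m \<noteq> n"
  then consider "m \<ge> n + 1" | "m + 1 \<le> n" by linarith
  then show False
  proof cases
    case 1
    then have "1 / real m \<le> 1 / (real n + 1)"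
      using assms by (intro divide_left_mono) auto
    moreover have "1 / real n - 1 / (real n + 1) = 1 / (real n * (real n + 1))"
      using assms by (simp add: field_simps)
    ultimately show False
      using assms(3) by linarith
  next
    case 2
    then have "1 / real m - 1 / real n = (real n - real m) / (real m * real n)"
      using assms by (simp add: field_simps)
    also have "\<dots> \<ge> 1 / (real n * (real n + 1))"
      using 2 assms by (intro frac_le) (auto simp: mult.commute)
    finally show False
      using assms(3) by linarith
  qed
qed

lemma open_contains_interval:
  fixes A :: "real set"
  assumes "open A" "a \<in> A"
  obtains e where "e > 0" "{a - e<..<a + e} \<subseteq> A"
  using assms open_contains_ball by (metis ball_eq_greaterThanLessThan)

text \<open>Small boxes serve as neighbourhoods. Around a floor point, every point of the box
  descends vertically to a rectangle in the floor. A point off the floor has \<open>a > 0\<close>,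
  so a small enough box meets just one plate, in a product of intervals.\<close>

lemma locally_connected_collapse_K0: "locally_connected_space (top_of_set (collapse ` K0))"
  unfolding locally_connected_space
proof clarify
  let ?Q = "collapse ` K0"
  fix V a b c assume V: "openin (top_of_set ?Q) V" "(a, b, c) \<in> V"
  then obtain T where T: "open T" "V = ?Q \<inter> T"
    by (auto simp: openin_open)
  have "(a, b, c) \<in> ?Q" "(a, b, c) \<in> T"
    using V(2) T by auto
  obtain A B' where A: "open A" "a \<in> A" "open B'" "(b, c) \<in> B'" "A \<times> B' \<subseteq> T"
    using open_prod_elim[OF T(1) \<open>(a, b, c) \<in> T\<close>] by (metis mem_Sigma_iff)
  obtain B C where B: "open B" "b \<in> B" "open C" "c \<in> C" "B \<times> C \<subseteq> B'"
    using open_prod_elim[OF A(3,4)] by (metis mem_Sigma_iff)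
  obtain i where i: "i > 0" "{a - i<..<a + i} \<subseteq> A"
    using open_contains_interval[OF A(1,2)] .
  obtain j where j: "j > 0" "{b - j<..<b + j} \<subseteq> B"
    using open_contains_interval[OF B(1,2)] .
  obtain k where k: "k > 0" "{c - k<..<c + k} \<subseteq> C"
    using open_contains_interval[OF B(3,4)] .
  \<comment> \<open>It remains to find a connected box. The first and third sides may still shrink:
    off the floor they must avoid the other plates and the floor.\<close>
  have box: "\<exists>U. openin (top_of_set ?Q) U \<and> connectedin (top_of_set ?Q) U \<and> (a, b, c) \<in> U \<and> U \<subseteq> V"
    if "0 < i'" "i' \<le> i" "0 < k'" "k' \<le> k"
      "connected (?Q \<inter> {a - i'<..<a + i'} \<times> {b - j<..<b + j} \<times> {c - k'<..<c + k'})"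
    for i' k'
  proof (intro exI conjI)
    let ?U = "?Q \<inter> {a - i'<..<a + i'} \<times> {b - j<..<b + j} \<times> {c - k'<..<c + k'}"
    show "openin (top_of_set ?Q) ?U"
      by (intro openin_open_Int open_Times) auto
    show "connectedin (top_of_set ?Q) ?U"
      using that by (simp add: connectedin_subtopology)
    show "(a, b, c) \<in> ?U"
      using that j \<open>(a, b, c) \<in> ?Q\<close> by simp
    have "{a - i'<..<a + i'} \<subseteq> A" "{c - k'<..<c + k'} \<subseteq> C"
      using that i k by (auto simp: subset_iff)
    then have "{a - i'<..<a + i'} \<times> {b - j<..<b + j} \<times> {c - k'<..<c + k'} \<subseteq> T"
      using j(2) A(5) B(5) by blast
    then show "?U \<subseteq> V"
      unfolding T(2) by (intro Int_mono order_refl)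
  qed
  show "\<exists>U. openin (top_of_set ?Q) U \<and> connectedin (top_of_set ?Q) U \<and> (a, b, c) \<in> U \<and> U \<subseteq> V"
  proof (cases "c = 0")
    case True
    have "connected (?Q \<inter> {a - i<..<a + i} \<times> {b - j<..<b + j} \<times> {c - k<..<c + k})" (is "connected ?U")
    proof (rule connected_vertical)
      have "{(x, y). (x, y, 0) \<in> ?U} = ({0..1} \<inter> {a - i<..<a + i}) \<times> ({0..1} \<inter> {b - j<..<b + j})"
        using True k(1) by (auto simp: collapse_K0_iff)
      then show "connected {(x, y). (x, y, 0) \<in> ?U}"
        by (simp only:) (intro connected_Times convex_connected convex_Int convex_real_interval)
    qed (use True in \<open>auto simp: collapse_K0_iff\<close>)
    then show ?thesis
      using i k by (intro box[of i k]) auto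
  next
    case False
    then obtain n :: nat where n: "n \<ge> 1" "a = 1 / real n" and "c > 0"
      using \<open>(a, b, c) \<in> ?Q\<close> by (auto simp: collapse_K0_iff)
    \<comment> \<open>The width \<open>i'\<close> excludes every reciprocal other than
      \<open>a\<close>. The height \<open>k' \<le> c\<close> keeps the box strictly above the floor,
      where only plates occur.\<close>
    define i' where "i' = min i (1 / (real n * (real n + 1)))"
    define k' where "k' = min k c"
    have pos: "0 < i'" "0 < k'"
      using i k n \<open>c > 0\<close> by (auto simp: i'_def k'_def)
    have iso: "x = a" if "(x, y, z) \<in> ?Q" "x \<in> {a - i'<..<a + i'}" "z > 0" for x y z
    proof -
      have "\<exists>m::nat. m \<ge> 1 \<and> x = 1 / real m"
        using that unfolding collapse_K0_iff by (metis less_irrefl)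
      then obtain m :: nat where m: "m \<ge> 1" "x = 1 / real m"
        by blast
      have "\<bar>x - a\<bar> < i'"
        using that(2) by (simp add: abs_less_iff)
      then have "\<bar>1 / real m - 1 / real n\<bar> < 1 / (real n * (real n + 1))"
        unfolding i'_def m(2) n(2) by linarith
      then show ?thesis
        using one_over_nat_isolated m n by blast
    qed
    have eq: "?Q \<inter> {a - i'<..<a + i'} \<times> {b - j<..<b + j} \<times> {c - k'<..<c + k'} =
      {a} \<times> ({0..1} \<inter> {b - j<..<b + j}) \<times> ({0..a} \<inter> {c - k'<..<c + k'})" (is "?U = ?P")
    proof
      show "?U \<subseteq> ?P"
      proof
        fix p assume "p \<in> ?U"
        moreover obtain x y z where p: "p = (x, y, z)"
          by (cases p)
        ultimately have xyz: "(x, y, z) \<in> ?Q" "x \<in> {a - i'<..<a + i'}" "y \<in> {b - j<..<b + j}"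
          "z \<in> {c - k'<..<c + k'}"
          by simp_all
        then have "z > 0"
          by (auto simp: k'_def)
        then have "x = a"
          using iso xyz by blast
        then show "p \<in> ?P"
          using xyz unfolding p collapse_K0_iff by simp
      qed
      show "?P \<subseteq> ?U"
      proof
        fix p assume "p \<in> ?P"
        then obtain y z where p: "p = (a, y, z)"
          and yz: "y \<in> {0..1}" "y \<in> {b - j<..<b + j}" "z \<in> {0..a}" "z \<in> {c - k'<..<c + k'}"
          by (cases p) simp
        have "a \<le> 1"
          using n by simp
        then have "(a, y, z) \<in> ?Q"
          unfolding collapse_K0_iff using yz n by auto
        then show "p \<in> ?U"
          unfolding p using yz pos by simp
      qed
    qed
    have "connected ?U"
      unfolding eq by (intro connected_Times convex_connected convex_Int convex_real_interval) auto
    then show ?thesis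
      using pos by (intro box[of i' k']) (simp_all add: i'_def k'_def)
  qed
qed

lemma continuous_on_collapse: "continuous_on S collapse"
  unfolding collapse_def case_prod_unfold by (intro continuous_intros)

lemma peano_continuum_collapse_K0: "peano_continuum (top_of_set (collapse ` K0))"
proof -
  have "K0 \<noteq> {}"
    using K0_iff[of 0 0 0] by auto
  moreover have "compact (collapse ` K0)" "connected (collapse ` K0)"
    using compact_K0 connected_K0 continuous_on_collapse
    by (auto intro: compact_continuous_image connected_continuous_image)
  ultimately show ?thesis
    using locally_connected_collapse_K0
    by (auto simp: peano_continuum_def continuum_def compactum_def compact_space_subtopology
        metrizable_space_euclidean metrizable_space_subtopology connected_space_subtopology)
qed


section \<open>Minimality\<close>

lemma no_reciprocal_between:
  assumes "1 / real (n + 2) < t" "t < 1 / real (n + 1)"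
  shows "t \<noteq> 1 / real m"
proof
  assume t: "t = 1 / real m"
  \<comment> \<open>Positivity of \<open>t\<close> excludes \<open>m = 0\<close>, for which
    \<open>1 / real m\<close> would be \<open>0\<close>.\<close>
  have "t > 0"
    using assms(1) by (smt (verit) divide_nonneg_nonneg of_nat_0_le_iff)
  then have "m > 0"
    using t by (cases "m = 0") auto
  then have "real m < real (n + 2)" "real (n + 1) < real m"
    using assms unfolding t by (simp_all add: divide_simps split: if_splits)
  then show False
    unfolding of_nat_less_iff by linarith
qed

text \<open>Continuity of the first coordinate on the quotient separates a part lying over \<open>x = 0\<close>,
  off the floor, from the plates converging to it, against local connectedness.\<close>

lemma part_over_0_meets_floor:
  assumes D: "peano_decomposition (top_of_set K0) \<D>"
    and fst_const: "\<And>\<delta> p q. \<delta> \<in> \<D> \<Longrightarrow> p \<in> \<delta> \<Longrightarrow> q \<in> \<delta> \<Longrightarrow> fst p = fst q"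
    and \<epsilon>: "\<epsilon> \<in> \<D>" "(0, b, c) \<in> \<epsilon>"
  shows "\<exists>p\<in>\<epsilon>. snd (snd p) = 0"
proof (rule ccontr)
  assume no: "\<not> (\<exists>p\<in>\<epsilon>. snd (snd p) = 0)"
  let ?X = "top_of_set K0"
  let ?Y = "decomposition_space ?X \<D>"
  define \<pi> where "\<pi> x = (SOME \<delta>. \<delta> \<in> \<D> \<and> x \<in> \<delta>)" for x
  \<comment> \<open>\<open>g\<close> is the first coordinate on the quotient, well defined by
    \<open>fst_const\<close>. It is continuous because \<open>g \<circ> \<pi>\<close> agrees with
    \<open>fst\<close> on \<open>K0\<close>.\<close>
  define g where "g \<delta> = fst (SOME x. x \<in> \<delta>)" for \<delta> :: "(real \<times> real \<times> real) set"
  have usc: "usc_decomposition ?X \<D>" and pY: "peano_compactum ?Y"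
    using D by (auto simp: peano_decomposition_def usc_decomposition_into_subcontinua_def)
  then have part: "partition_on K0 \<D>"
    by (simp add: usc_decomposition_def)
  then have part': "partition_on (topspace ?X) \<D>"
    by simp
  have topY: "topspace ?Y = \<D>"
    by (rule topspace_decomposition_space[OF part'])
  have \<D>: "\<Union>\<D> = K0"
    using part by (simp add: partition_on_def)
  have \<pi>: "\<pi> x \<in> \<D> \<and> x \<in> \<pi> x" if "x \<in> K0" for x
    unfolding \<pi>_def using that \<D> by (intro someI_ex[of "\<lambda>\<delta>. \<delta> \<in> \<D> \<and> x \<in> \<delta>"]) blast
  have g: "g \<delta> = fst x" if "\<delta> \<in> \<D>" "x \<in> \<delta>" for \<delta> x
    unfolding g_def by (rule fst_const[OF that(1) someI that(2)]) (rule that(2))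
  have q: "quotient_map ?X ?Y \<pi>"
    by (rule quotient_map_decomposition_space[OF part']) (use \<pi> in simp)
  have "continuous_map ?X euclideanreal (g \<circ> \<pi>)"
  proof (rule continuous_map_eq)
    show "continuous_map ?X euclideanreal fst"
      by (simp add: continuous_on_fst continuous_on_id)
  qed (use \<pi> g in \<open>metis comp_apply topspace_euclidean_subtopology\<close>)
  then have cg: "continuous_map ?Y euclideanreal g"
    using continuous_compose_quotient_map[OF q] by blast
  have "connectedin ?Y (\<pi> ` topspace ?X)"
    using q connected_K0 by (intro connectedin_continuous_map_image[OF quotient_imp_continuous_map])
      (auto simp: connectedin_subtopology)
  then have "connected_space ?Y"
    using q by (simp add: quotient_map_def connectedin_topspace)
  \<comment> \<open>The part of a floor point differs from \<open>\<epsilon>\<close>, so the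
    connected quotient is nondegenerate and therefore locally connected.\<close>
  moreover have K0_0: "(0, 0, 0) \<in> K0"
    by (simp add: K0_iff)
  then have "\<pi> (0, 0, 0) \<noteq> \<epsilon>"
    using no \<pi> by force
  ultimately have "locally_connected_space ?Y"
    using locally_connected_if_peano_compactum[OF pY] \<epsilon>(1) \<pi>[OF K0_0] topY by blast
  \<comment> \<open>Off the floor, first coordinates are \<open>0\<close> or reciprocals. Upper
    semi-continuity then gives a union of parts around \<open>\<epsilon>\<close> inside
    \<open>U\<close>, that is, an open set of the quotient.\<close>
  define U where "U = K0 \<inter> {p. 0 < snd (snd p)}"
  have "openin ?X U"
    unfolding U_def by (intro openin_open_Int open_Collect_less continuous_intros)
  moreover have "\<epsilon> \<subseteq> U"
  proof
    fix p assume p: "p \<in> \<epsilon>"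
    then have "p \<in> K0"
      using \<epsilon>(1) \<D> by blast
    then show "p \<in> U"
      using p no by (cases p) (force simp: U_def K0_iff)
  qed
  ultimately obtain V \<E> where V: "openin ?X V" "\<epsilon> \<subseteq> V" "V \<subseteq> U" "\<E> \<subseteq> \<D>" "V = \<Union>\<E>"
    using usc \<epsilon>(1) unfolding usc_decomposition_def by metis
  have "\<epsilon> \<in> \<E>"
  proof -
    obtain \<delta> where "\<delta> \<in> \<E>" "(0, b, c) \<in> \<delta>"
      using V \<epsilon>(2) by blast
    then show ?thesis
      using disjointD[OF partition_onD2[OF part], of \<delta> \<epsilon>] \<epsilon> V(4) by blast
  qed
  moreover have "openin ?Y \<E>"
    using V openin_decomposition_space[OF part'] by blast
  ultimately obtain W where W: "openin ?Y W" "connectedin ?Y W" "\<epsilon> \<in> W" "W \<subseteq> \<E>"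
    using \<open>locally_connected_space ?Y\<close> unfolding locally_connected_space by metis
  have "openin ?X (\<Union>W)"
    using W(1) openin_decomposition_space[OF part'] by blast
  then obtain T where T: "open T" "\<Union>W = K0 \<inter> T"
    by (auto simp: openin_open)
  \<comment> \<open>The copies of \<open>(0, b, c)\<close> on the plates converge to it, so the
    connected neighbourhood \<open>W\<close> contains the part of one of them.\<close>
  have "(\<lambda>n. (1 / real (Suc n), b, c)) \<longlonglongrightarrow> (0, b, c)"
    by (intro tendsto_intros lim_1_over_n[THEN LIMSEQ_Suc])
  moreover have "(0, b, c) \<in> T"
    using T W(3) \<epsilon>(2) by blast
  ultimately have "\<forall>\<^sub>F n in sequentially. (1 / real (Suc n), b, c) \<in> T"
    using T(1) topological_tendstoD by blast
  then obtain n where n: "(1 / real (Suc n), b, c) \<in> T"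
    unfolding eventually_sequentially by blast
  have "(0, b, c) \<in> K0"
    using \<epsilon> \<D> by blast
  moreover have "n + 1 \<ge> 1" "1 / real (n + 1) \<le> 1" "0 \<le> 1 / real (n + 1)"
    by simp_all
  ultimately have "(1 / real (n + 1), b, c) \<in> K0"
    unfolding K0_iff by blast
  then have "(1 / real (n + 1), b, c) \<in> \<Union>W"
    using n T(2) by simp
  then obtain \<delta> where \<delta>: "\<delta> \<in> W" "(1 / real (n + 1), b, c) \<in> \<delta>"
    by blast
  have "W \<subseteq> \<D>"
    using W(4) V(4) by blast
  then have ends: "0 \<in> g ` W" "1 / real (n + 1) \<in> g ` W"
    using g[of \<epsilon> "(0, b, c)"] g[of \<delta> "(1 / real (n + 1), b, c)"] \<epsilon> \<delta> W(3) by force+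
  \<comment> \<open>The image is an interval containing \<open>0\<close> and
    \<open>1 / (n + 1)\<close>, hence also values strictly between two consecutive reciprocals,
    which no point of \<open>U\<close> has as first coordinate.\<close>
  have "connected (g ` W)"
    using connectedin_continuous_map_image[OF cg W(2)] by simp
  have "1 / real (n + 2) < 1 / real (n + 1)"
    by (rule divide_strict_left_mono) auto
  then obtain t where t: "1 / real (n + 2) < t" "t < 1 / real (n + 1)"
    using dense by blast
  moreover have "0 < 1 / real (n + 2)"
    by simp
  ultimately have "0 < t"
    by linarith
  have "t \<in> g ` W"
    using connectedD_interval[OF \<open>connected (g ` W)\<close> ends, of t] \<open>0 < t\<close> t by simp
  then obtain \<zeta> where \<zeta>: "\<zeta> \<in> W" "t = g \<zeta>"
    by blast
  then have "\<zeta> \<in> \<D>"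
    using \<open>W \<subseteq> \<D>\<close> by blast
  then obtain x y z where xyz: "(x, y, z) \<in> \<zeta>"
    using partition_onD3[OF part] by (metis ex_in_conv prod_cases3)
  then have "x = t" "(x, y, z) \<in> U"
    using g[OF \<open>\<zeta> \<in> \<D>\<close> xyz] \<zeta> W(4) V(3,5) by auto
  then obtain m :: nat where "t = 1 / real m"
    using \<open>0 < t\<close> by (auto simp: U_def K0_iff)
  then show False
    using no_reciprocal_between t by blast
qed

text \<open>By \<open>nondeg\<close>, an element of \<open>\<D>\<close> with several points lies
  over \<open>x = 0\<close> and has at most one floor point. If it split into several parts of
  \<open>\<D>'\<close>, each of them would contain a floor point, hence the same one, against
  disjointness.\<close>

lemma peano_refinement_eq:
  assumes D: "peano_decomposition (top_of_set K0) \<D>'" and ref: "refines K0 \<D>' \<D>"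
    and nondeg: "\<And>\<delta> p q. \<delta> \<in> \<D> \<Longrightarrow> p \<in> \<delta> \<Longrightarrow> q \<in> \<delta> \<Longrightarrow> p \<noteq> q \<Longrightarrow>
      fst p = 0 \<and> fst q = 0 \<and> (snd (snd p) \<noteq> 0 \<or> snd (snd q) \<noteq> 0)"
  shows "\<D>' = \<D>"
proof -
  have parts: "partition_on K0 \<D>'" "partition_on K0 \<D>"
    using ref by (auto simp: refines_def)
  have ex: "\<exists>\<delta>'\<in>\<D>. \<delta> \<subseteq> \<delta>'" if "\<delta> \<in> \<D>'" for \<delta>
    using ref that by (auto simp: refines_def)
  have const: "fst p = fst q" if "\<delta> \<in> \<D>'" "p \<in> \<delta>" "q \<in> \<delta>" for \<delta> p q
    using ex[OF that(1)] nondeg that by (metis subsetD)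
  have floor: "\<exists>p\<in>\<delta>. snd (snd p) = 0" if "\<delta> \<in> \<D>'" "p \<in> \<delta>" "fst p = 0" for \<delta> p
    using part_over_0_meets_floor[OF D const that(1)] that(2,3) by (cases p) auto
  have uniq': "\<delta>1 = \<delta>2" if "\<delta>1 \<in> \<D>'" "\<delta>2 \<in> \<D>'" "p \<in> \<delta>1" "p \<in> \<delta>2" for \<delta>1 \<delta>2 p
    using disjointD[OF partition_onD2[OF parts(1)], of \<delta>1 \<delta>2] that by blast
  have uniq: "\<delta>1 = \<delta>2" if "\<delta>1 \<in> \<D>" "\<delta>2 \<in> \<D>" "p \<in> \<delta>1" "p \<in> \<delta>2" for \<delta>1 \<delta>2 p
    using disjointD[OF partition_onD2[OF parts(2)], of \<delta>1 \<delta>2] that by blast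
  have sub: "\<delta> \<in> \<D>" if \<delta>: "\<delta> \<in> \<D>'" for \<delta>
  proof -
    obtain \<delta>' where \<delta>': "\<delta>' \<in> \<D>" "\<delta> \<subseteq> \<delta>'"
      using ex[OF \<delta>] by blast
    obtain p where p: "p \<in> \<delta>"
      using \<delta> partition_onD3[OF parts(1)] by (metis ex_in_conv)
    have "q \<in> \<delta>" if q: "q \<in> \<delta>'" for q
    proof (rule ccontr)
      assume "q \<notin> \<delta>"
      then have fst0: "fst p = 0" "fst q = 0"
        using nondeg[of \<delta>' p q] \<delta>' p q by auto
      have "q \<in> \<Union>\<D>'"
        using q \<delta>'(1) parts by (auto simp: partition_on_def)
      then obtain \<epsilon> where \<epsilon>: "\<epsilon> \<in> \<D>'" "q \<in> \<epsilon>"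
        by blast
      then have "\<epsilon> \<subseteq> \<delta>'"
        using ex[OF \<epsilon>(1)] uniq[OF \<delta>'(1) _ q] by blast
      obtain r where r: "r \<in> \<delta>" "snd (snd r) = 0"
        using floor[OF \<delta> p fst0(1)] by blast
      obtain s where s: "s \<in> \<epsilon>" "snd (snd s) = 0"
        using floor[OF \<epsilon> fst0(2)] by blast
      have "r = s"
        using nondeg[OF \<delta>'(1), of r s] r s \<delta>'(2) \<open>\<epsilon> \<subseteq> \<delta>'\<close> by blast
      then have "\<delta> = \<epsilon>"
        using uniq'[OF \<delta> \<epsilon>(1) r(1)] s(1) by simp
      then show False
        using \<epsilon>(2) \<open>q \<notin> \<delta>\<close> by simp
    qed
    then have "\<delta> = \<delta>'"
      using \<delta>'(2) by blast
    then show ?thesis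
      using \<delta>'(1) by simp
  qed
  show ?thesis
  proof
    show "\<D> \<subseteq> \<D>'"
    proof
      fix \<delta> assume \<delta>: "\<delta> \<in> \<D>"
      then obtain p where p: "p \<in> \<delta>"
        using partition_onD3[OF parts(2)] by (metis ex_in_conv)
      then have "p \<in> \<Union>\<D>'"
        using \<delta> parts by (auto simp: partition_on_def)
      then obtain \<epsilon> where "\<epsilon> \<in> \<D>'" "p \<in> \<epsilon>"
        by blast
      then show "\<delta> \<in> \<D>'"
        using uniq[OF \<delta> sub p] by blast
    qed
  qed (use sub in blast)
qed

section \<open>Atomic decompositions into fibres\<close>

text \<open>Stated for any \<open>f\<close> onto the collapsed space, so that it covers both
  \<open>collapse\<close> and its composition with the inverse of \<open>h l\<close>. Surjectivity
  gives the Peano quotient, \<open>nondeg\<close> gives minimality.\<close>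

lemma atomic_decomposition_fibres:
  assumes f: "continuous_on K0 f" "f ` K0 = collapse ` K0"
    and conn: "\<And>\<delta>. \<delta> \<in> fibres (top_of_set K0) f \<Longrightarrow> connected \<delta>"
    and nondeg: "\<And>p q. p \<in> K0 \<Longrightarrow> q \<in> K0 \<Longrightarrow> f p = f q \<Longrightarrow> p \<noteq> q \<Longrightarrow>
      fst p = 0 \<and> fst q = 0 \<and> (snd (snd p) \<noteq> 0 \<or> snd (snd q) \<noteq> 0)"
  shows "atomic_decomposition (top_of_set K0) (fibres (top_of_set K0) f)"
proof -
  have "peano_decomposition (top_of_set K0) (fibres (top_of_set K0) f)"
  proof (rule peano_decomposition_fibres[OF compactum_K0 peano_continuum_collapse_K0])
    show "continuous_map (top_of_set K0) (top_of_set (collapse ` K0)) f"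
      using f by (simp add: continuous_map_in_subtopology flip: f(2))
    show "connectedin (top_of_set K0) \<delta>" if "\<delta> \<in> fibres (top_of_set K0) f" for \<delta>
      using conn[OF that] that by (auto simp: connectedin_subtopology fibres_def)
  qed (use f in simp)
  moreover have "\<D>' = fibres (top_of_set K0) f"
    if "peano_decomposition (top_of_set K0) \<D>'" "refines K0 \<D>' (fibres (top_of_set K0) f)" for \<D>'
  proof (rule peano_refinement_eq[OF that])
    fix \<delta> p q assume "\<delta> \<in> fibres (top_of_set K0) f" "p \<in> \<delta>" "q \<in> \<delta>" "p \<noteq> q"
    moreover from this have "p \<in> K0" "q \<in> K0" "f p = f q"
      by (auto simp: fibres_def)
    ultimately show "fst p = 0 \<and> fst q = 0 \<and> (snd (snd p) \<noteq> 0 \<or> snd (snd q) \<noteq> 0)"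
      using nondeg by blast
  qed
  ultimately show ?thesis
    unfolding atomic_decomposition_def topspace_euclidean_subtopology by blast
qed

lemma collapse_eq_iff:
  "collapse (x, y, z) = collapse (x', y', z') \<longleftrightarrow> x = x' \<and> y = y' \<and> (x = 0 \<or> z = z')"
  by (auto simp: collapse_def)

lemma D1_eq_fibres: "D1 = fibres (top_of_set K0) collapse"
proof (intro set_eqI iffI)
  fix \<delta> assume "\<delta> \<in> D1"
  then consider (segment) y where "y \<in> {0..1}" "\<delta> = {0} \<times> {y} \<times> {0..1}"
    | (point) x y z where "(x, y, z) \<in> K0" "x > 0" "\<delta> = {(x, y, z)}"
    by (auto simp: D1_def)
  then show "\<delta> \<in> fibres (top_of_set K0) collapse"
  proof cases
    case segment
    \<comment> \<open>The floor end of the segment represents its fibre.\<close>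
    then have "(0, y, 0) \<in> K0" "\<delta> = {p \<in> K0. collapse p = collapse (0, y, 0)}"
      by (auto simp: K0_iff collapse_eq_iff)
    then show ?thesis
      by (auto simp: fibres_def)
  next
    case point
    then have "\<delta> = {p \<in> K0. collapse p = collapse (x, y, z)}"
      by (auto simp: collapse_eq_iff)
    then show ?thesis
      using point(1) by (auto simp: fibres_def)
  qed
next
  fix \<delta> assume "\<delta> \<in> fibres (top_of_set K0) collapse"
  then obtain x y z where xyz: "(x, y, z) \<in> K0" and \<delta>: "\<delta> = {p \<in> K0. collapse p = collapse (x, y, z)}"
    by (auto simp: fibres_def)
  show "\<delta> \<in> D1"
  proof (cases "x = 0")
    case True
    then have "\<delta> = {0} \<times> {y} \<times> {0..1}"
      using xyz unfolding \<delta> by (auto simp: K0_iff collapse_eq_iff)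
    moreover have "y \<in> {0..1}"
      using xyz by (simp add: K0_iff)
    ultimately show ?thesis
      by (auto simp: D1_def)
  next
    case False
    then have "\<delta> = {(x, y, z)}" "x > 0"
      using xyz unfolding \<delta> by (auto simp: collapse_eq_iff) (auto simp: K0_iff)
    then show ?thesis
      using xyz by (auto simp: D1_def)
  qed
qed

lemma connected_D1: "\<delta> \<in> D1 \<Longrightarrow> connected \<delta>"
  by (auto simp: D1_def intro!: connected_Times)

text \<open>Distinct points with equal image have \<open>x = 0\<close> and the same
  \<open>y\<close>, so their heights differ and cannot both be \<open>0\<close>.\<close>

lemma collapse_nondegenerate:
  assumes "collapse p = collapse q" "p \<noteq> q"
  shows "fst p = 0 \<and> fst q = 0 \<and> (snd (snd p) \<noteq> 0 \<or> snd (snd q) \<noteq> 0)"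
  using assms by (cases p; cases q) (auto simp: collapse_eq_iff)

section \<open>The homeomorphisms\<close>

text \<open>With the weight in \<open>[0, 1]\<close>, \<open>h l\<close> moves \<open>y\<close> at
  height \<open>z\<close> to a convex combination of \<open>y\<close> and
  \<open>y powr l\<close>.\<close>

lemma shear_weight:
  fixes z :: real
  assumes "0 \<le> z" "z \<le> 1"
  shows "0 \<le> 4 * z * (1 - z)" "4 * z * (1 - z) \<le> 1"
proof -
  show "0 \<le> 4 * z * (1 - z)"
    using assms by simp
  have "0 \<le> (2 * z - 1)\<^sup>2"
    by simp
  then show "4 * z * (1 - z) \<le> 1"
    by (simp add: power2_eq_square algebra_simps)
qed

text \<open>A convex combination of two strictly increasing functions is strictly increasing. For
  \<open>t = 1\<close> the strictness comes from the power, otherwise from the linear term.\<close>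

lemma powr_interpolation_strict_mono:
  fixes x y t l :: real
  assumes "0 < l" "0 \<le> t" "t \<le> 1" "0 \<le> x" "x < y"
  shows "x + t * (x powr l - x) < y + t * (y powr l - y)"
proof (cases "t = 1")
  case True
  then show ?thesis
    using powr_less_mono2[of l x y] assms by simp
next
  case False
  have "x powr l \<le> y powr l"
    using assms by (intro powr_mono2) auto
  then have "t * x powr l \<le> t * y powr l"
    using assms by (intro mult_left_mono) auto
  moreover have "(1 - t) * x < (1 - t) * y"
    using assms False by (intro mult_strict_left_mono) auto
  ultimately show ?thesis
    by (simp add: algebra_simps)
qed

lemma continuous_on_powr_interpolation:
  fixes S :: "real set"
  assumes "0 < l" "S \<subseteq> {0..}"
  shows "continuous_on S (\<lambda>x. x + t * (x powr l - x))"
  using assms by (intro continuous_intros continuous_on_powr') auto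

lemma powr_interpolation_image:
  fixes t l :: real
  assumes "0 < l" "0 \<le> t" "t \<le> 1"
  shows "(\<lambda>x. x + t * (x powr l - x)) ` {0..1} = {0..1}" (is "?g ` _ = _")
proof
  \<comment> \<open>Both endpoints are fixed, so monotonicity gives one inclusion and the
    intermediate value theorem the other.\<close>
  have ends: "?g 0 = 0" "?g 1 = 1"
    using assms by auto
  have mono: "?g x \<le> ?g y" if "0 \<le> x" "x \<le> y" for x y
    using powr_interpolation_strict_mono[OF assms, of x y] that by (cases "x = y") auto
  show "?g ` {0..1} \<subseteq> {0..1}"
    using mono[of 0] mono[of _ 1] ends by auto
  show "{0..1} \<subseteq> ?g ` {0..1}"
  proof
    fix y :: real assume "y \<in> {0..1}"
    then have "\<exists>x\<ge>0. x \<le> 1 \<and> ?g x = y"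
      using assms by (intro IVT' continuous_on_powr_interpolation) (auto simp: ends)
    then show "y \<in> ?g ` {0..1}"
      by auto
  qed
qed

lemma h_eq: "h l (x, y, z) = (x, y + 4 * z * (1 - z) * (y powr l - y), z)"
  by (simp add: h_def)

text \<open>Only \<open>y\<close> moves, and membership in \<open>K0\<close> restricts
  \<open>y\<close> just to \<open>[0, 1]\<close>, which the interpolation at each height maps onto
  itself.\<close>

lemma h_image_K0:
  assumes "0 < l"
  shows "h l ` K0 = K0"
proof
  have image: "(\<lambda>y. y + 4 * z * (1 - z) * (y powr l - y)) ` {0..1} = {0..1}"
    if "0 \<le> z" "z \<le> 1" for z
    using powr_interpolation_image[OF assms shear_weight[OF that]] .
  show "h l ` K0 \<subseteq> K0"
  proof (rule image_subsetI)
    fix p assume "p \<in> K0"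
    moreover obtain x y z where p: "p = (x, y, z)"
      by (cases p)
    ultimately have K: "(x, y, z) \<in> K0"
      by simp
    have "0 \<le> z" "z \<le> 1" "y \<in> {0..1}"
      using K by (auto simp: K0_iff)
    then have "y + 4 * z * (1 - z) * (y powr l - y) \<in> {0..1}"
      using image by blast
    then show "h l p \<in> K0"
      using K unfolding p h_eq K0_iff by simp
  qed
  show "K0 \<subseteq> h l ` K0"
  proof clarify
    fix x y z assume K: "(x, y, z) \<in> K0"
    have "0 \<le> z" "z \<le> 1" "y \<in> {0..1}"
      using K by (auto simp: K0_iff)
    then obtain v where v: "v \<in> {0..1}" "y = v + 4 * z * (1 - z) * (v powr l - v)"
      using image by blast
    have "(x, v, z) \<in> K0"
      using K v(1) unfolding K0_iff by simp
    moreover have "h l (x, v, z) = (x, y, z)"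
      using v(2) by (simp add: h_eq)
    ultimately show "(x, y, z) \<in> h l ` K0"
      by (metis image_eqI)
  qed
qed

lemma h_inj_on_K0:
  assumes "0 < l"
  shows "inj_on (h l) K0"
proof (rule inj_onI)
  fix p q assume pq: "p \<in> K0" "q \<in> K0" "h l p = h l q"
  obtain x y z where p: "p = (x, y, z)" by (cases p)
  obtain y' where q: "q = (x, y', z)"
    using pq(3) by (cases q) (simp add: p h_eq)
  have "0 \<le> z" "z \<le> 1" "0 \<le> y" "0 \<le> y'"
    using pq(1,2) by (auto simp: p q K0_iff)
  moreover have "y + 4 * z * (1 - z) * (y powr l - y) = y' + 4 * z * (1 - z) * (y' powr l - y')"
    using pq(3) by (simp add: p q h_eq)
  ultimately have "y = y'"
    using powr_interpolation_strict_mono[OF assms shear_weight] by (metis less_irrefl linorder_neqE)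
  then show "p = q"
    by (simp add: p q)
qed

text \<open>A continuous bijection from a compact space onto a Hausdorff space is a
  homeomorphism.\<close>

lemma homeomorphic_map_h:
  assumes "0 < l"
  shows "homeomorphic_map (top_of_set K0) (top_of_set K0) (h l)"
proof (rule continuous_imp_homeomorphic_map)
  have "continuous_on K0 (h l)"
    unfolding h_def case_prod_unfold using assms
    by (intro continuous_intros continuous_on_powr') (auto simp: K0_iff)
  then show "continuous_map (top_of_set K0) (top_of_set K0) (h l)"
    using h_image_K0[OF assms] by (auto simp: continuous_map_in_subtopology)
qed (use assms compact_K0 h_image_K0 h_inj_on_K0 in
  \<open>auto simp: compact_space_subtopology Hausdorff_space_subtopology\<close>)

theorem proposition7p3:
  shows "atomic_decomposition (top_of_set K0) D1 \<and>
    (\<forall>l\<in>{0<..<1}.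
       homeomorphic_map (top_of_set K0) (top_of_set K0) (h l) \<and>
       atomic_decomposition (top_of_set K0) {h l ` \<delta> |\<delta>. \<delta> \<in> D1})"
proof (intro conjI ballI)
  show "atomic_decomposition (top_of_set K0) D1"
    unfolding D1_eq_fibres
    by (rule atomic_decomposition_fibres[OF continuous_on_collapse])
      (use connected_D1 D1_eq_fibres collapse_nondegenerate in auto)
next
  fix l :: real assume "l \<in> {0<..<1}"
  then have l: "0 < l"
    by simp
  show hom: "homeomorphic_map (top_of_set K0) (top_of_set K0) (h l)"
    by (rule homeomorphic_map_h[OF l])
  then obtain g where g: "homeomorphic_maps (top_of_set K0) (top_of_set K0) (h l) g"
    using homeomorphic_map_maps by blast
  then have cg: "continuous_on K0 g" and ch: "continuous_on K0 (h l)"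
    by (auto simp: homeomorphic_maps_def continuous_map_in_subtopology)
  have gK: "g ` K0 = K0"
    using g homeomorphic_imp_surjective_map[of "top_of_set K0" "top_of_set K0" g]
    by (metis homeomorphic_maps_map topspace_euclidean_subtopology)
  have hg: "h l (g p) = p" if "p \<in> K0" for p
    using g that by (simp add: homeomorphic_maps_def)
  \<comment> \<open>Since \<open>h l\<close> preserves the first and third coordinates, so does its
    inverse \<open>g\<close>. This carries the nondegeneracy condition over from
    \<open>collapse\<close> to \<open>collapse \<circ> g\<close>.\<close>
  have coords: "fst (g p) = fst p" "snd (snd (g p)) = snd (snd p)" if "p \<in> K0" for p
    using hg[OF that] by (cases "g p"; auto simp: h_eq)+
  have fib: "{h l ` \<delta> |\<delta>. \<delta> \<in> D1} = fibres (top_of_set K0) (collapse \<circ> g)"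
    using fibres_comp_homeomorphic[OF g, of collapse] D1_eq_fibres by auto
  show "atomic_decomposition (top_of_set K0) {h l ` \<delta> |\<delta>. \<delta> \<in> D1}"
    unfolding fib
  proof (rule atomic_decomposition_fibres)
    show "continuous_on K0 (collapse \<circ> g)"
      using cg continuous_on_collapse by (rule continuous_on_compose)
    show "(collapse \<circ> g) ` K0 = collapse ` K0"
      by (metis gK image_comp)
  next
    fix \<delta> assume "\<delta> \<in> fibres (top_of_set K0) (collapse \<circ> g)"
    then obtain \<delta>' where \<delta>': "\<delta>' \<in> D1" "\<delta> = h l ` \<delta>'"
      unfolding fib[symmetric] by blast
    then have "\<delta>' \<subseteq> K0"
      unfolding D1_eq_fibres by (auto simp: fibres_def)
    then have "continuous_on \<delta>' (h l)"
      using ch continuous_on_subset by blast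
    then show "connected \<delta>"
      unfolding \<delta>'(2) using connected_D1[OF \<delta>'(1)] by (rule connected_continuous_image)
  next
    fix p q assume pq: "p \<in> K0" "q \<in> K0" "(collapse \<circ> g) p = (collapse \<circ> g) q" "p \<noteq> q"
    then have "collapse (g p) = collapse (g q)" "g p \<noteq> g q"
      using hg[OF pq(1)] hg[OF pq(2)] by auto
    from collapse_nondegenerate[OF this]
    show "fst p = 0 \<and> fst q = 0 \<and> (snd (snd p) \<noteq> 0 \<or> snd (snd q) \<noteq> 0)"
      unfolding coords[OF pq(1)] coords[OF pq(2)] .
  qed
qed

end
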